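(* Let $\mathbb K$ be an algebraically closed field of characteristic $0$, let $(L,[\,,],\{\,,,\})$ be a Lie-Yamaguti algebra over $\mathbb K$, let $n\ge1$, and let $(F_1,G_1),\dots,(F_n,G_n)\in C^{(2,3)}(L;L)$ define an $n$-th order deformation of $L$. Define, for $a,b,c,d,e\in L$, $$R(a,b,c,d)=\sum_{\substack{i+j=n+1\\ i,j\ge1}}\Big(G_i(a,b,F_j(c,d))-F_i(G_j(a,b,c),d)-F_i(c,G_j(a,b,d))\Big),$$ $$S(a,b,c,d,e)=\sum_{\substack{i+j=n+1\\ i,j\ge1}}\Big(G_i(a,b,G_j(c,d,e))-G_i(G_j(a,b,c),d,e)-G_i(c,G_j(a,b,d),e)-G_i(c,d,G_j(a,b,e))\Big).$$ Then $(R,S)\in C^{(4,5)}(L;L)$ is a $(4,5)$-cocycle, i.e. $\delta(R,S)=0$.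
   Context: A Lie-Yamaguti algebra $(L,[\,,],\{\,,,\})$ over $\mathbb K$ is a $\mathbb K$-vector space with a bilinear map $[\,,]:L\times L\to L$ and a trilinear map $\{\,,,\}:L\times L\times L\to L$ such that for all $x,y,z,u,v,w\in L$ (with $\sum_{\circlearrowleft(x,y,z)}$ the sum over cyclic permutations of $x,y,z$): (LY1) $[x,y]=-[y,x]$; (LY2) $\{x,y,z\}=-\{y,x,z\}$; (LY3) $\sum_{\circlearrowleft(x,y,z)}([[x,y],z]+\{x,y,z\})=0$; (LY4) $\sum_{\circlearrowleft(x,y,z)}\{[x,y],z,u\}=0$; (LY5) $\{x,y,[u,v]\}=[\{x,y,u\},v]+[u,\{x,y,v\}]$; (LY6) $\{x,y,\{u,v,w\}\}=\{\{x,y,u\},v,w\}+\{u,\{x,y,v\},w\}+\{u,v,\{x,y,w\}\}$. Cochains (adjoint coefficients). For $p\ge1$, $C^{(2p,2p+1)}(L;L)$ is the space of pairs $(f,g)$ with $f:L^{2p}\to L$ $2p$-linear and $g:L^{2p+1}\to L$ $(2p+1)$-linear, each vanishing whenever $x_{2i-1}=x_{2i}$ for some $1\le i\le p$. For $(f,g)\in C^{(2,3)}(L;L)$ put $\delta(f,g)=(\delta_If,\delta_{II}g)\in C^{(4,5)}(L;L)$ and $\delta^*(f,g)=(\delta^*_If,\delta^*_{II}g)$, where (each component may depend on both $f$ and $g$) $\delta_If(a,b,c,d)=-[c,g(a,b,d)]+[d,g(a,b,c)]+g(a,b,[c,d])+\{a,b,f(c,d)\}-f(\{a,b,c\},d)-f(c,\{a,b,d\})$;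 $\delta_{II}g(a,b,c,d,e)=-\{g(a,b,c),d,e\}+\{g(a,b,d),c,e\}+\{a,b,g(c,d,e)\}-\{c,d,g(a,b,e)\}-g(\{a,b,c\},d,e)-g(c,\{a,b,d\},e)-g(c,d,\{a,b,e\})+g(a,b,\{c,d,e\})$; $\delta^*_If(a,b,c)=-[a,f(b,c)]-[b,f(c,a)]-[c,f(a,b)]+f([a,b],c)+f([b,c],a)+f([c,a],b)+g(a,b,c)+g(b,c,a)+g(c,a,b)$; $\delta^*_{II}g(a,b,c,d)=\{f(b,c),a,d\}+\{f(c,a),b,d\}+\{f(a,b),c,d\}+g([a,b],c,d)+g([b,c],a,d)+g([c,a],b,d)$. For $(f,g)\in C^{(4,5)}(L;L)$ put $\delta(f,g)=(\delta_If,\delta_{II}g)\in C^{(6,7)}(L;L)$, where $\delta_If(x_1,\dots,x_6)=[x_5,g(x_1,x_2,x_3,x_4,x_6)]-[x_6,g(x_1,\dots,x_5)]-g(x_1,x_2,x_3,x_4,[x_5,x_6])+\{x_1,x_2,f(x_3,x_4,x_5,x_6)\}-\{x_3,x_4,f(x_1,x_2,x_5,x_6)\}-\sum_{j=3}^{6}f(x_3,\dots,\{x_1,x_2,x_j\},\dots,x_6)+\sum_{j=5}^{6}f(x_1,x_2,\dots,\{x_3,x_4,x_j\},\dots,x_6)$ (in the first sum the arguments are $x_3,\dots,x_6$ with $x_j$ replaced by $\{x_1,x_2,x_j\}$; in the second $x_1,x_2,x_5,x_6$ with $x_j$ replaced by $\{x_3,x_4,x_j\}$); $\delta_{II}g(x_1,\dots,x_7)=\{g(x_1,\dots,x_5),x_6,x_7\}-\{g(x_1,x_2,x_3,x_4,x_6),x_5,x_7\}+\{x_1,x_2,g(x_3,\dots,x_7)\}-\{x_3,x_4,g(x_1,x_2,x_5,x_6,x_7)\}+\{x_5,x_6,g(x_1,x_2,x_3,x_4,x_7)\}-\sum_{j=3}^{7}g(x_3,\dots,\{x_1,x_2,x_j\},\dots,x_7)+\sum_{j=5}^{7}g(x_1,x_2,\dots,\{x_3,x_4,x_j\},\dots,x_7)-g(x_1,x_2,x_3,x_4,\{x_5,x_6,x_7\})$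 (first sum: arguments $x_3,\dots,x_7$ with $x_j$ replaced; second sum: arguments $x_1,x_2,x_5,x_6,x_7$ with $x_j$ replaced). $n$-th order deformation: cochains $(F_\nu,G_\nu)\in C^{(2,3)}(L;L)$, $1\le\nu\le n$, such that for every $1\le\nu\le n$ and all $a,b,c,d,e\in L$ (sums over $i+j=\nu$, $i,j>0$; on the right the components of $\delta^*(F_\nu,G_\nu)$ and $\delta(F_\nu,G_\nu)$): $\sum\sum_{\circlearrowleft(a,b,c)}F_i(F_j(a,b),c)=-\delta^*_IF_\nu(a,b,c)$; $\sum\sum_{\circlearrowleft(a,b,c)}G_i(F_j(a,b),c,d)=-\delta^*_{II}G_\nu(a,b,c,d)$; $\sum\big(G_i(a,b,F_j(c,d))-F_i(G_j(a,b,c),d)-F_i(c,G_j(a,b,d))\big)=-\delta_IF_\nu(a,b,c,d)$; $\sum\big(G_i(a,b,G_j(c,d,e))-G_i(G_j(a,b,c),d,e)-G_i(c,G_j(a,b,d),e)-G_i(c,d,G_j(a,b,e))\big)=-\delta_{II}G_\nu(a,b,c,d,e)$. *)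

theory Defs
  imports Complex_Main "HOL-Computational_Algebra.Polynomial"
begin

text \<open>
  A \<open>K\<close>-vector space is given by a scalar multiplication \<open>scale\<close> on an additive group type, as in
  the locale \<^locale>\<open>vector_space\<close>. Multilinear maps are curried.
\<close>

definition multilinear2 ::
  "('k::field \<Rightarrow> 'v::ab_group_add \<Rightarrow> 'v) \<Rightarrow> ('v \<Rightarrow> 'v \<Rightarrow> 'v) \<Rightarrow> bool" where
  "multilinear2 scale f \<longleftrightarrow>
     (\<forall>y. Vector_Spaces.linear scale scale (\<lambda>x. f x y)) \<and>
     (\<forall>x. Vector_Spaces.linear scale scale (f x))"

definition multilinear3 ::
  "('k::field \<Rightarrow> 'v::ab_group_add \<Rightarrow> 'v) \<Rightarrow> ('v \<Rightarrow> 'v \<Rightarrow> 'v \<Rightarrow> 'v) \<Rightarrow> bool" where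
  "multilinear3 scale f \<longleftrightarrow>
     (\<forall>y z. Vector_Spaces.linear scale scale (\<lambda>x. f x y z)) \<and>
     (\<forall>x. multilinear2 scale (f x))"

definition multilinear4 ::
  "('k::field \<Rightarrow> 'v::ab_group_add \<Rightarrow> 'v) \<Rightarrow> ('v \<Rightarrow> 'v \<Rightarrow> 'v \<Rightarrow> 'v \<Rightarrow> 'v) \<Rightarrow> bool" where
  "multilinear4 scale f \<longleftrightarrow>
     (\<forall>y z u. Vector_Spaces.linear scale scale (\<lambda>x. f x y z u)) \<and>
     (\<forall>x. multilinear3 scale (f x))"

definition multilinear5 ::
  "('k::field \<Rightarrow> 'v::ab_group_add \<Rightarrow> 'v) \<Rightarrow> ('v \<Rightarrow> 'v \<Rightarrow> 'v \<Rightarrow> 'v \<Rightarrow> 'v \<Rightarrow> 'v) \<Rightarrow> bool" where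
  "multilinear5 scale f \<longleftrightarrow>
     (\<forall>y z u v. Vector_Spaces.linear scale scale (\<lambda>x. f x y z u v)) \<and>
     (\<forall>x. multilinear4 scale (f x))"

definition cyclic_sum :: "('v \<Rightarrow> 'v \<Rightarrow> 'v \<Rightarrow> 'v::ab_group_add) \<Rightarrow> 'v \<Rightarrow> 'v \<Rightarrow> 'v \<Rightarrow> 'v" where
  "cyclic_sum h x y z = h x y z + h y z x + h z x y"

text \<open>Here \<open>br x y\<close> is \<open>[x,y]\<close> and \<open>tr x y z\<close> is \<open>{x,y,z}\<close>.\<close>

locale lie_yamaguti = vector_space scale
  for scale :: "'k::field \<Rightarrow> 'v::ab_group_add \<Rightarrow> 'v" +
  fixes br :: "'v \<Rightarrow> 'v \<Rightarrow> 'v"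
    and tr :: "'v \<Rightarrow> 'v \<Rightarrow> 'v \<Rightarrow> 'v"
  assumes br_bilinear: "multilinear2 scale br"
    and tr_trilinear: "multilinear3 scale tr"
    and LY1: "br x y = - br y x"
    and LY2: "tr x y z = - tr y x z"
    and LY3: "cyclic_sum (\<lambda>x y z. br (br x y) z + tr x y z) x y z = 0"
    and LY4: "cyclic_sum (\<lambda>x y z. tr (br x y) z u) x y z = 0"
    and LY5: "tr x y (br u v) = br (tr x y u) v + br u (tr x y v)"
    and LY6: "tr x y (tr u v w) = tr (tr x y u) v w + tr u (tr x y v) w + tr u v (tr x y w)"

definition cochains23 ::
  "('k::field \<Rightarrow> 'v::ab_group_add \<Rightarrow> 'v) \<Rightarrow>
   (('v \<Rightarrow> 'v \<Rightarrow> 'v) \<times> ('v \<Rightarrow> 'v \<Rightarrow> 'v \<Rightarrow> 'v)) set" where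
  "cochains23 scale = {(f, g).
     multilinear2 scale f \<and> multilinear3 scale g \<and>
     (\<forall>x. f x x = 0) \<and> (\<forall>x c. g x x c = 0)}"

definition cochains45 ::
  "('k::field \<Rightarrow> 'v::ab_group_add \<Rightarrow> 'v) \<Rightarrow>
   (('v \<Rightarrow> 'v \<Rightarrow> 'v \<Rightarrow> 'v \<Rightarrow> 'v) \<times> ('v \<Rightarrow> 'v \<Rightarrow> 'v \<Rightarrow> 'v \<Rightarrow> 'v \<Rightarrow> 'v)) set" where
  "cochains45 scale = {(f, g).
     multilinear4 scale f \<and> multilinear5 scale g \<and>
     (\<forall>x c d. f x x c d = 0) \<and> (\<forall>a b x. f a b x x = 0) \<and>
     (\<forall>x c d e. g x x c d e = 0) \<and> (\<forall>a b x e. g a b x x e = 0)}"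

text \<open>The components of \<open>\<delta>\<close> and \<open>\<delta>\<^sup>*\<close> on \<open>C\<^bsup>(2,3)\<^esup>(L;L)\<close>.\<close>

definition delta23_I ::
  "('v \<Rightarrow> 'v \<Rightarrow> 'v) \<Rightarrow> ('v \<Rightarrow> 'v \<Rightarrow> 'v \<Rightarrow> 'v) \<Rightarrow>
   ('v \<Rightarrow> 'v \<Rightarrow> 'v) \<times> ('v \<Rightarrow> 'v \<Rightarrow> 'v \<Rightarrow> 'v) \<Rightarrow>
   'v \<Rightarrow> 'v \<Rightarrow> 'v \<Rightarrow> 'v \<Rightarrow> 'v::ab_group_add" where
  "delta23_I br tr = (\<lambda>(f, g) a b c d.
     - br c (g a b d) + br d (g a b c) + g a b (br c d)
     + tr a b (f c d) - f (tr a b c) d - f c (tr a b d))"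

definition delta23_II ::
  "('v \<Rightarrow> 'v \<Rightarrow> 'v \<Rightarrow> 'v) \<Rightarrow>
   ('v \<Rightarrow> 'v \<Rightarrow> 'v) \<times> ('v \<Rightarrow> 'v \<Rightarrow> 'v \<Rightarrow> 'v) \<Rightarrow>
   'v \<Rightarrow> 'v \<Rightarrow> 'v \<Rightarrow> 'v \<Rightarrow> 'v \<Rightarrow> 'v::ab_group_add" where
  "delta23_II tr = (\<lambda>(f, g) a b c d e.
     - tr (g a b c) d e + tr (g a b d) c e + tr a b (g c d e) - tr c d (g a b e)
     - g (tr a b c) d e - g c (tr a b d) e - g c d (tr a b e) + g a b (tr c d e))"

definition delta_star_I ::
  "('v \<Rightarrow> 'v \<Rightarrow> 'v) \<Rightarrow>
   ('v \<Rightarrow> 'v \<Rightarrow> 'v) \<times> ('v \<Rightarrow> 'v \<Rightarrow> 'v \<Rightarrow> 'v) \<Rightarrow>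
   'v \<Rightarrow> 'v \<Rightarrow> 'v \<Rightarrow> 'v::ab_group_add" where
  "delta_star_I br = (\<lambda>(f, g) a b c.
     - br a (f b c) - br b (f c a) - br c (f a b)
     + f (br a b) c + f (br b c) a + f (br c a) b
     + g a b c + g b c a + g c a b)"

definition delta_star_II ::
  "('v \<Rightarrow> 'v \<Rightarrow> 'v) \<Rightarrow> ('v \<Rightarrow> 'v \<Rightarrow> 'v \<Rightarrow> 'v) \<Rightarrow>
   ('v \<Rightarrow> 'v \<Rightarrow> 'v) \<times> ('v \<Rightarrow> 'v \<Rightarrow> 'v \<Rightarrow> 'v) \<Rightarrow>
   'v \<Rightarrow> 'v \<Rightarrow> 'v \<Rightarrow> 'v \<Rightarrow> 'v::ab_group_add" where
  "delta_star_II br tr = (\<lambda>(f, g) a b c d.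
     tr (f b c) a d + tr (f c a) b d + tr (f a b) c d
     + g (br a b) c d + g (br b c) a d + g (br c a) b d)"

text \<open>The coboundary \<open>\<delta>\<close> on \<open>C\<^bsup>(4,5)\<^esup>(L;L)\<close>, with the sums over \<open>j\<close> written out.\<close>

definition delta45_I ::
  "('v \<Rightarrow> 'v \<Rightarrow> 'v) \<Rightarrow> ('v \<Rightarrow> 'v \<Rightarrow> 'v \<Rightarrow> 'v) \<Rightarrow>
   ('v \<Rightarrow> 'v \<Rightarrow> 'v \<Rightarrow> 'v \<Rightarrow> 'v) \<times> ('v \<Rightarrow> 'v \<Rightarrow> 'v \<Rightarrow> 'v \<Rightarrow> 'v \<Rightarrow> 'v) \<Rightarrow>
   'v \<Rightarrow> 'v \<Rightarrow> 'v \<Rightarrow> 'v \<Rightarrow> 'v \<Rightarrow> 'v \<Rightarrow> 'v::ab_group_add" where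
  "delta45_I br tr = (\<lambda>(f, g) x1 x2 x3 x4 x5 x6.
     br x5 (g x1 x2 x3 x4 x6) - br x6 (g x1 x2 x3 x4 x5) - g x1 x2 x3 x4 (br x5 x6)
     + tr x1 x2 (f x3 x4 x5 x6) - tr x3 x4 (f x1 x2 x5 x6)
     - (f (tr x1 x2 x3) x4 x5 x6 + f x3 (tr x1 x2 x4) x5 x6
        + f x3 x4 (tr x1 x2 x5) x6 + f x3 x4 x5 (tr x1 x2 x6))
     + (f x1 x2 (tr x3 x4 x5) x6 + f x1 x2 x5 (tr x3 x4 x6)))"

definition delta45_II ::
  "('v \<Rightarrow> 'v \<Rightarrow> 'v \<Rightarrow> 'v) \<Rightarrow>
   ('v \<Rightarrow> 'v \<Rightarrow> 'v \<Rightarrow> 'v \<Rightarrow> 'v) \<times> ('v \<Rightarrow> 'v \<Rightarrow> 'v \<Rightarrow> 'v \<Rightarrow> 'v \<Rightarrow> 'v) \<Rightarrow>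
   'v \<Rightarrow> 'v \<Rightarrow> 'v \<Rightarrow> 'v \<Rightarrow> 'v \<Rightarrow> 'v \<Rightarrow> 'v \<Rightarrow> 'v::ab_group_add" where
  "delta45_II tr = (\<lambda>(f, g) x1 x2 x3 x4 x5 x6 x7.
     tr (g x1 x2 x3 x4 x5) x6 x7 - tr (g x1 x2 x3 x4 x6) x5 x7
     + tr x1 x2 (g x3 x4 x5 x6 x7) - tr x3 x4 (g x1 x2 x5 x6 x7) + tr x5 x6 (g x1 x2 x3 x4 x7)
     - (g (tr x1 x2 x3) x4 x5 x6 x7 + g x3 (tr x1 x2 x4) x5 x6 x7
        + g x3 x4 (tr x1 x2 x5) x6 x7 + g x3 x4 x5 (tr x1 x2 x6) x7
        + g x3 x4 x5 x6 (tr x1 x2 x7))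
     + (g x1 x2 (tr x3 x4 x5) x6 x7 + g x1 x2 x5 (tr x3 x4 x6) x7
        + g x1 x2 x5 x6 (tr x3 x4 x7))
     - g x1 x2 x3 x4 (tr x5 x6 x7))"

definition delta45 where
  "delta45 br tr fg = (delta45_I br tr fg, delta45_II tr fg)"

definition cocycles45 ::
  "('k::field \<Rightarrow> 'v::ab_group_add \<Rightarrow> 'v) \<Rightarrow>
   ('v \<Rightarrow> 'v \<Rightarrow> 'v) \<Rightarrow> ('v \<Rightarrow> 'v \<Rightarrow> 'v \<Rightarrow> 'v) \<Rightarrow>
   (('v \<Rightarrow> 'v \<Rightarrow> 'v \<Rightarrow> 'v \<Rightarrow> 'v) \<times> ('v \<Rightarrow> 'v \<Rightarrow> 'v \<Rightarrow> 'v \<Rightarrow> 'v \<Rightarrow> 'v)) set" where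
  "cocycles45 scale br tr = {fg \<in> cochains45 scale.
     delta45 br tr fg = ((\<lambda>_ _ _ _ _ _. 0), (\<lambda>_ _ _ _ _ _ _. 0))}"

definition pos_splits :: "nat \<Rightarrow> (nat \<times> nat) set" where
  "pos_splits m = {(i, j). i + j = m \<and> 0 < i \<and> 0 < j}"

text \<open>
  The quadratic expressions for \<open>m \<le> n\<close> occur in the equations of an \<open>n\<close>-th order deformation;
  for \<open>m = n + 1\<close> they are \<open>R\<close> and \<open>S\<close>.
\<close>

definition quad_R ::
  "(nat \<Rightarrow> 'v \<Rightarrow> 'v \<Rightarrow> 'v) \<Rightarrow> (nat \<Rightarrow> 'v \<Rightarrow> 'v \<Rightarrow> 'v \<Rightarrow> 'v) \<Rightarrow> nat \<Rightarrow>
   'v \<Rightarrow> 'v \<Rightarrow> 'v \<Rightarrow> 'v \<Rightarrow> 'v::ab_group_add" where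
  "quad_R F G m a b c d = (\<Sum>(i, j)\<in>pos_splits m.
     G i a b (F j c d) - F i (G j a b c) d - F i c (G j a b d))"

definition quad_S ::
  "(nat \<Rightarrow> 'v \<Rightarrow> 'v \<Rightarrow> 'v \<Rightarrow> 'v) \<Rightarrow> nat \<Rightarrow>
   'v \<Rightarrow> 'v \<Rightarrow> 'v \<Rightarrow> 'v \<Rightarrow> 'v \<Rightarrow> 'v::ab_group_add" where
  "quad_S G m a b c d e = (\<Sum>(i, j)\<in>pos_splits m.
     G i a b (G j c d e) - G i (G j a b c) d e - G i c (G j a b d) e - G i c d (G j a b e))"

text \<open>Only the values of \<open>F\<close> and \<open>G\<close> at \<open>1, \<dots>, n\<close> matter.\<close>

definition nth_order_deformation ::
  "('k::field \<Rightarrow> 'v::ab_group_add \<Rightarrow> 'v) \<Rightarrow>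
   ('v \<Rightarrow> 'v \<Rightarrow> 'v) \<Rightarrow> ('v \<Rightarrow> 'v \<Rightarrow> 'v \<Rightarrow> 'v) \<Rightarrow> nat \<Rightarrow>
   (nat \<Rightarrow> 'v \<Rightarrow> 'v \<Rightarrow> 'v) \<Rightarrow> (nat \<Rightarrow> 'v \<Rightarrow> 'v \<Rightarrow> 'v \<Rightarrow> 'v) \<Rightarrow> bool" where
  "nth_order_deformation scale br tr n F G \<longleftrightarrow>
     (\<forall>\<nu>\<in>{1..n}. (F \<nu>, G \<nu>) \<in> cochains23 scale \<and>
        (\<forall>a b c. (\<Sum>(i, j)\<in>pos_splits \<nu>. cyclic_sum (\<lambda>a b c. F i (F j a b) c) a b c)
           = - delta_star_I br (F \<nu>, G \<nu>) a b c) \<and>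
        (\<forall>a b c d. (\<Sum>(i, j)\<in>pos_splits \<nu>. cyclic_sum (\<lambda>a b c. G i (F j a b) c d) a b c)
           = - delta_star_II br tr (F \<nu>, G \<nu>) a b c d) \<and>
        (\<forall>a b c d. quad_R F G \<nu> a b c d = - delta23_I br tr (F \<nu>, G \<nu>) a b c d) \<and>
        (\<forall>a b c d e. quad_S G \<nu> a b c d e = - delta23_II tr (F \<nu>, G \<nu>) a b c d e))"

end

theory Submission
  imports Defs "HOL-Computational_Algebra.Formal_Power_Series"
begin

text \<open>
  Put \<open>F\<^sub>0 = [,]\<close>, \<open>G\<^sub>0 = {,,}\<close>, let \<open>F\<^sub>i = 0\<close> and \<open>G\<^sub>i = 0\<close> for \<open>i > n\<close>, and extend the families
  \<open>\<Sum>\<^sub>i t\<^sup>i F\<^sub>i\<close> and \<open>\<Sum>\<^sub>i t\<^sup>i G\<^sub>i\<close> to products \<open>f\<close> and \<open>g\<close> on the power series \<open>V[[t]]\<close> that are linear in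
  each argument and compatible with multiplication by \<open>t\<close>. For an additive map \<open>D\<close> and a product
  \<open>h\<close>, write \<open>D\<cdot>h\<close> for the defect of \<open>D\<close> from being a derivation of \<open>h\<close>. With
  \<open>D\<^sub>a\<^sub>b = g(a,b,-)\<close>, the last two families of equations of a deformation say that the defects
  \<open>P\<^sub>a\<^sub>b = D\<^sub>a\<^sub>b\<cdot>f\<close> and \<open>Q\<^sub>a\<^sub>b = D\<^sub>a\<^sub>b\<cdot>g\<close> vanish modulo \<open>t\<^sup>n\<^sup>+\<^sup>1\<close> at
  arguments from \<open>V\<close> (at \<open>t\<^sup>0\<close> these are the axioms LY5 and
  LY6). Since \<open>F\<^sub>n\<^sub>+\<^sub>1\<close> and \<open>G\<^sub>n\<^sub>+\<^sub>1\<close> are zero, their coefficients at \<open>t\<^sup>n\<^sup>+\<^sup>1\<close> are \<open>R\<close> and \<open>S\<close>.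

  The action \<open>D \<mapsto> D\<cdot>h\<close> is a representation of the commutator Lie algebra, and by definition
  \<open>Q\<^sub>a\<^sub>b(c,d,-)\<close> is \<open>[D\<^sub>a\<^sub>b, D\<^sub>c\<^sub>d] - D\<^bsub>g(a,b,c),d\<^esub> - D\<^bsub>c,g(a,b,d)\<^esub>\<close>. Letting it act on \<open>f\<close> gives the
  Bianchi-type identity
  \<open>Q\<^sub>a\<^sub>b(c,d,-)\<cdot>f = D\<^sub>a\<^sub>b\<cdot>P\<^sub>c\<^sub>d - D\<^sub>c\<^sub>d\<cdot>P\<^sub>a\<^sub>b - P\<^bsub>g(a,b,c),d\<^esub> - P\<^bsub>c,g(a,b,d)\<^esub>\<close>,
  and letting it act on \<open>g\<close> gives the same with \<open>Q\<close> in place of \<open>P\<close> (\<open>bianchi2\<close>, \<open>bianchi3\<close>). These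
  hold for arbitrary additive products.

  All terms are of order \<open>t\<^sup>n\<^sup>+\<^sup>1\<close>, and in the coefficient at \<open>t\<^sup>n\<^sup>+\<^sup>1\<close> every \<open>P\<close> and \<open>Q\<close> contributes \<open>R\<close> or
  \<open>S\<close>, while every remaining \<open>f\<close> and \<open>g\<close> contributes its constant term, \<open>[,]\<close> or \<open>{,,}\<close>
  (\<open>leading_bianchi2\<close>, \<open>leading_bianchi3\<close>). After moving arguments by skew-symmetry, the resulting
  two identities are the two components of \<open>\<delta>(R,S) = 0\<close>.
\<close>

unbundle fps_syntax

section \<open>Derivation defects\<close>

definition defect2 :: "('a \<Rightarrow> 'a) \<Rightarrow> ('a \<Rightarrow> 'a \<Rightarrow> 'a) \<Rightarrow> 'a \<Rightarrow> 'a \<Rightarrow> 'a::ab_group_add" where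
  "defect2 D f x y = D (f x y) - f (D x) y - f x (D y)"

definition defect3 ::
  "('a \<Rightarrow> 'a) \<Rightarrow> ('a \<Rightarrow> 'a \<Rightarrow> 'a \<Rightarrow> 'a) \<Rightarrow> 'a \<Rightarrow> 'a \<Rightarrow> 'a \<Rightarrow> 'a::ab_group_add" where
  "defect3 D g x y z = D (g x y z) - g (D x) y z - g x (D y) z - g x y (D z)"

locale additive_products =
  fixes f :: "'a \<Rightarrow> 'a \<Rightarrow> 'a::ab_group_add" and g :: "'a \<Rightarrow> 'a \<Rightarrow> 'a \<Rightarrow> 'a"
  assumes f_add: "f (x + x') y = f x y + f x' y" "f x (y + y') = f x y + f x y'"
    and g_add: "g (x + x') y z = g x y z + g x' y z"
      "g x (y + y') z = g x y z + g x y' z"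
      "g x y (z + z') = g x y z + g x y z'"
begin

lemma f_additive: "additive (\<lambda>x. f x y)" "additive (f x)"
  by (unfold_locales; simp add: f_add)+

lemma g_additive: "additive (\<lambda>x. g x y z)" "additive (\<lambda>y. g x y z)" "additive (g x y)"
  by (unfold_locales; simp add: g_add)+

lemmas zeros [simp] = f_additive[THEN additive.zero] g_additive[THEN additive.zero]
lemmas diffs = f_additive[THEN additive.diff] g_additive[THEN additive.diff]

text \<open>
  \<open>defect3 (g a b) g c d\<close>, as a map of its last argument, is the commutator of \<open>g a b\<close> and \<open>g c d\<close>
  minus \<open>g (g a b c) d\<close> and \<open>g c (g a b d)\<close>, and taking defects turns commutators of maps into
  commutators of operators: the terms in which the two maps act on different arguments of the product
  are symmetric in the two maps and cancel.
\<close>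

lemma bianchi2:
  "defect2 (defect3 (g a b) g c d) f x y =
     defect2 (g a b) (defect2 (g c d) f) x y - defect2 (g c d) (defect2 (g a b) f) x y
     - defect2 (g (g a b c) d) f x y - defect2 (g c (g a b d)) f x y"
  unfolding defect2_def defect3_def by (simp add: diffs)

lemma bianchi3:
  "defect3 (defect3 (g a b) g c d) g x y z =
     defect3 (g a b) (defect3 (g c d) g) x y z - defect3 (g c d) (defect3 (g a b) g) x y z
     - defect3 (g (g a b c) d) g x y z - defect3 (g c (g a b d)) g x y z"
  unfolding defect3_def by (simp add: diffs)

end

section \<open>Additive maps of formal power series\<close>

definition times_t :: "'v::zero fps \<Rightarrow> 'v fps" where
  "times_t x = Abs_fps (\<lambda>m. case m of 0 \<Rightarrow> 0 | Suc k \<Rightarrow> x $ k)"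

lemma times_t_nth [simp]: "times_t x $ 0 = 0" "times_t x $ Suc m = x $ m"
  by (simp_all add: times_t_def)

lemma times_t_diff: "times_t (x - y) = times_t x - times_t (y :: 'v::ab_group_add fps)"
  by (rule fps_ext) (simp add: times_t_def split: nat.split)

lemma fps_head_tail: "x = fps_const (x $ 0) + times_t (fps_shift 1 x)"
  for x :: "'v::ab_group_add fps"
proof (rule fps_ext)
  show "x $ m = (fps_const (x $ 0) + times_t (fps_shift 1 x)) $ m" for m
    by (cases m) auto
qed

text \<open>
  Splitting a series into its constant term and a multiple of \<open>t\<close> determines such a map, coefficient
  by coefficient, from its values on constant series.
\<close>

locale t_linear =
  fixes T :: "'v::ab_group_add fps \<Rightarrow> 'v fps"
  assumes T_add: "T (x + y) = T x + T y"
    and T_times_t: "T (times_t x) = times_t (T x)"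
begin

lemma head_tail: "T x = T (fps_const (x $ 0)) + times_t (T (fps_shift 1 x))"
  by (subst fps_head_tail) (simp only: T_add T_times_t)

text \<open>If \<open>x = t\<^sup>N x'\<close>, then \<open>T x = t\<^sup>N T x'\<close>, with lowest coefficient \<open>(T x')\<^sub>0\<close>.\<close>

lemma nth_leading_argument:
  "(\<And>m. m < N \<Longrightarrow> x $ m = 0) \<Longrightarrow> T x $ N = T (fps_const (x $ N)) $ 0"
proof (induction N arbitrary: x)
  case 0
  show ?case by (subst head_tail) simp
next
  case (Suc N)
  interpret additive T by unfold_locales (rule T_add)
  have "x $ 0 = 0" using Suc.prems by simp
  then have "T x = times_t (T (fps_shift 1 x))"
    by (subst head_tail) (simp add: zero)
  moreover have "fps_shift 1 x $ m = 0" if "m < N" for m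
    using Suc.prems[of "Suc m"] that by simp
  ultimately show ?case using Suc.IH[of "fps_shift 1 x"] by simp
qed

text \<open>
  Dually, if \<open>T\<close> itself is divisible by \<open>t\<^sup>N\<close>, which can be tested on constants, then the coefficient
  of \<open>T x\<close> at \<open>t\<^sup>N\<close> sees only the constant term of \<open>x\<close>.
\<close>

lemma nth_below:
  assumes "\<And>m c. m < N \<Longrightarrow> T (fps_const c) $ m = 0" and "m < N"
  shows "T x $ m = 0"
  using assms(2)
proof (induction m arbitrary: x)
  case 0
  then show ?case by (subst head_tail) (simp add: assms(1))
next
  case (Suc m)
  then show ?case by (subst head_tail) (simp add: assms(1))
qed

lemma nth_leading_map:
  assumes "\<And>m c. m < N \<Longrightarrow> T (fps_const c) $ m = 0"
  shows "T x $ N = T (fps_const (x $ 0)) $ N"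
proof (cases N)
  case 0
  then show ?thesis by (subst head_tail) simp
next
  case (Suc k)
  then show ?thesis by (subst head_tail) (simp add: nth_below[OF assms])
qed

end

section \<open>Families of products as products of formal power series\<close>

text \<open>The series \<open>\<Sum>\<^sub>i t\<^sup>i A\<^sub>i\<close>.\<close>

definition fps_series :: "(nat \<Rightarrow> 'v::ab_group_add fps) \<Rightarrow> 'v fps" where
  "fps_series A = Abs_fps (\<lambda>m. \<Sum>i\<le>m. A i $ (m - i))"

lemma fps_series_nth: "fps_series A $ m = (\<Sum>i\<le>m. A i $ (m - i))"
  by (simp add: fps_series_def)

lemma fps_series_add: "fps_series (\<lambda>i. A i + B i) = fps_series A + fps_series B"
  by (rule fps_ext) (simp add: fps_series_nth sum.distrib)

lemma fps_series_zero: "fps_series (\<lambda>i. 0) = 0"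
  by (rule fps_ext) (simp add: fps_series_nth)

lemma fps_series_times_t: "fps_series (\<lambda>i. times_t (A i)) = times_t (fps_series A)"
proof (rule fps_ext)
  fix m
  show "fps_series (\<lambda>i. times_t (A i)) $ m = times_t (fps_series A) $ m"
    by (cases m) (simp_all add: fps_series_nth Suc_diff_le)
qed

text \<open>
  The extension \<open>\<Sum>\<^sub>i t\<^sup>i x\<^sub>i \<mapsto> \<Sum>\<^sub>i t\<^sup>i H(x\<^sub>i)\<close> of an additive \<open>H : V \<rightarrow> V[[t]]\<close>. Nesting it extends a
  multilinear map one argument at a time, so that the properties of the extension need to be checked
  for one variable only.
\<close>

definition fps_bind :: "'v fps \<Rightarrow> ('v \<Rightarrow> 'v fps) \<Rightarrow> 'v::ab_group_add fps" where
  "fps_bind x H = fps_series (\<lambda>i. H (x $ i))"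

lemma fps_bind_zero: "fps_bind x (\<lambda>a. 0) = 0"
  by (simp add: fps_bind_def fps_series_zero)

lemma fps_bind_add_left:
  "(\<And>a b. H (a + b) = H a + H b) \<Longrightarrow> fps_bind (x + y) H = fps_bind x H + fps_bind y H"
  by (simp add: fps_bind_def fps_series_add)

lemma fps_bind_add_right: "fps_bind x (\<lambda>a. H a + K a) = fps_bind x H + fps_bind x K"
  by (simp add: fps_bind_def fps_series_add)

lemma fps_bind_times_t_left:
  assumes "H 0 = 0"
  shows "fps_bind (times_t x) H = times_t (fps_bind x H)"
proof (rule fps_ext)
  fix m
  show "fps_bind (times_t x) H $ m = times_t (fps_bind x H) $ m"
    by (cases m)
      (simp_all add: fps_bind_def fps_series_nth assms sum.atMost_Suc_shift del: sum.atMost_Suc)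
qed

lemma fps_bind_times_t_right: "fps_bind x (\<lambda>a. times_t (H a)) = times_t (fps_bind x H)"
  by (simp add: fps_bind_def fps_series_times_t)

lemma fps_bind_const_left:
  assumes "H 0 = 0"
  shows "fps_bind (fps_const c) H = H c"
proof (rule fps_ext)
  fix m
  show "fps_bind (fps_const c) H $ m = H c $ m"
    by (cases m)
      (simp_all add: fps_bind_def fps_series_nth assms sum.atMost_Suc_shift del: sum.atMost_Suc)
qed

lemma fps_bind_const_right_nth: "fps_bind x (\<lambda>a. fps_const (h a)) $ m = h (x $ m)"
proof -
  have "(\<Sum>i\<le>m. fps_const (h (x $ i)) $ (m - i)) = (\<Sum>i\<le>m. if i = m then h (x $ i) else 0)"
    by (rule sum.cong) auto
  then show ?thesis by (simp add: fps_bind_def fps_series_nth)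
qed

definition fps_ext2 :: "(nat \<Rightarrow> 'v \<Rightarrow> 'v \<Rightarrow> 'v) \<Rightarrow> 'v fps \<Rightarrow> 'v fps \<Rightarrow> 'v::ab_group_add fps" where
  "fps_ext2 F x y =
     fps_series (\<lambda>i. fps_bind x (\<lambda>a. fps_bind y (\<lambda>b. fps_const (F i a b))))"

definition fps_ext3 ::
  "(nat \<Rightarrow> 'v \<Rightarrow> 'v \<Rightarrow> 'v \<Rightarrow> 'v) \<Rightarrow> 'v fps \<Rightarrow> 'v fps \<Rightarrow> 'v fps \<Rightarrow> 'v::ab_group_add fps" where
  "fps_ext3 G x y z =
     fps_series (\<lambda>i. fps_bind x (\<lambda>a. fps_bind y (\<lambda>b. fps_bind z (\<lambda>c. fps_const (G i a b c)))))"

locale additive_families =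
  fixes F :: "nat \<Rightarrow> 'v \<Rightarrow> 'v \<Rightarrow> 'v::ab_group_add" and G :: "nat \<Rightarrow> 'v \<Rightarrow> 'v \<Rightarrow> 'v \<Rightarrow> 'v"
  assumes family: "additive_products (F i) (G i)"
begin

sublocale coeff: additive_products "F i" "G i" for i
  by (rule family)

sublocale ext: additive_products "fps_ext2 F" "fps_ext3 G"
  by unfold_locales
    (simp_all add: fps_ext2_def fps_ext3_def coeff.f_add coeff.g_add fps_series_add
      fps_bind_add_left fps_bind_add_right fps_const_add[symmetric] del: fps_const_add)

lemma ext_times_t:
  "fps_ext2 F (times_t x) y = times_t (fps_ext2 F x y)"
  "fps_ext2 F x (times_t y) = times_t (fps_ext2 F x y)"
  "fps_ext3 G (times_t x) y z = times_t (fps_ext3 G x y z)"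
  "fps_ext3 G x (times_t y) z = times_t (fps_ext3 G x y z)"
  "fps_ext3 G x y (times_t z) = times_t (fps_ext3 G x y z)"
  by (simp_all add: fps_ext2_def fps_ext3_def fps_series_times_t fps_bind_zero
      fps_bind_times_t_left fps_bind_times_t_right)

text \<open>
  In a composite of two products at constant arguments, the outer product has only one non-constant
  argument, so these cases suffice for the coefficients of the defects.
\<close>

lemma ext_one_variable_nth:
  "fps_ext2 F x (fps_const b) $ m = (\<Sum>i\<le>m. F i (x $ (m - i)) b)"
  "fps_ext2 F (fps_const a) y $ m = (\<Sum>i\<le>m. F i a (y $ (m - i)))"
  "fps_ext3 G x (fps_const b) (fps_const c) $ m = (\<Sum>i\<le>m. G i (x $ (m - i)) b c)"
  "fps_ext3 G (fps_const a) y (fps_const c) $ m = (\<Sum>i\<le>m. G i a (y $ (m - i)) c)"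
  "fps_ext3 G (fps_const a) (fps_const b) z $ m = (\<Sum>i\<le>m. G i a b (z $ (m - i)))"
  by (simp_all add: fps_ext2_def fps_ext3_def fps_series_nth fps_bind_zero
      fps_bind_const_left fps_bind_const_right_nth)

lemma ext_const_nth:
  "fps_ext2 F (fps_const a) (fps_const b) $ m = F m a b"
  "fps_ext3 G (fps_const a) (fps_const b) (fps_const c) $ m = G m a b c"
proof -
  have last: "(\<Sum>i\<le>m. h i (fps_const c $ (m - i))) = h m c" if "\<And>i. h i 0 = 0"
    for h :: "nat \<Rightarrow> 'v \<Rightarrow> 'v" and c
  proof -
    have "(\<Sum>i\<le>m. h i (fps_const c $ (m - i))) = (\<Sum>i\<le>m. if i = m then h i c else 0)"
      by (rule sum.cong) (auto simp: that)
    then show ?thesis by simp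
  qed
  show "fps_ext2 F (fps_const a) (fps_const b) $ m = F m a b"
    unfolding ext_one_variable_nth by (rule last) simp
  show "fps_ext3 G (fps_const a) (fps_const b) (fps_const c) $ m = G m a b c"
    unfolding ext_one_variable_nth by (rule last) simp
qed

lemma ext_t_linear:
  "t_linear (\<lambda>x. fps_ext2 F x y)" "t_linear (fps_ext2 F x)"
  "t_linear (\<lambda>x. fps_ext3 G x y z)" "t_linear (\<lambda>y. fps_ext3 G x y z)" "t_linear (fps_ext3 G x y)"
  by (unfold_locales; simp add: ext.f_add ext.g_add ext_times_t)+

abbreviation P where "P a b \<equiv> defect2 (fps_ext3 G a b) (fps_ext2 F)"
abbreviation Q where "Q a b \<equiv> defect3 (fps_ext3 G a b) (fps_ext3 G)"

lemma P_t_linear: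
  "t_linear (\<lambda>a. P a b c d)" "t_linear (\<lambda>b. P a b c d)"
  "t_linear (\<lambda>c. P a b c d)" "t_linear (P a b c)"
  by (unfold_locales;
      simp add: defect2_def ext.f_add ext.g_add ext_times_t times_t_diff)+

lemma Q_t_linear:
  "t_linear (\<lambda>a. Q a b c d e)" "t_linear (\<lambda>b. Q a b c d e)"
  "t_linear (\<lambda>c. Q a b c d e)" "t_linear (\<lambda>d. Q a b c d e)" "t_linear (Q a b c d)"
  by (unfold_locales;
      simp add: defect3_def ext.f_add ext.g_add ext_times_t times_t_diff)+

lemma P_const_nth:
  "P (fps_const a) (fps_const b) (fps_const c) (fps_const d) $ m =
     (\<Sum>i\<le>m. G i a b (F (m - i) c d) - F i (G (m - i) a b c) d - F i c (G (m - i) a b d))"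
  by (simp add: defect2_def ext_const_nth ext_one_variable_nth(1)[of "fps_ext3 G _ _ _"]
      ext_one_variable_nth(2)[of _ "fps_ext3 G _ _ _"]
      ext_one_variable_nth(5)[of _ _ "fps_ext2 F _ _"] sum_subtractf)

lemma Q_const_nth:
  "Q (fps_const a) (fps_const b) (fps_const c) (fps_const d) (fps_const e) $ m =
     (\<Sum>i\<le>m. G i a b (G (m - i) c d e) - G i (G (m - i) a b c) d e
        - G i c (G (m - i) a b d) e - G i c d (G (m - i) a b e))"
  by (simp add: defect3_def ext_const_nth ext_one_variable_nth(3)[of "fps_ext3 G _ _ _"]
      ext_one_variable_nth(4)[of _ "fps_ext3 G _ _ _"]
      ext_one_variable_nth(5)[of _ _ "fps_ext3 G _ _ _"] sum_subtractf)

text \<open>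
  Now the defects are divisible by \<open>t\<^sup>N\<close> with leading coefficients \<open>R\<close> and \<open>S\<close>. In the Bianchi
  identities at constant arguments, each \<open>P\<close> and \<open>Q\<close> has at most one non-constant argument, so
  \<open>nth_leading_map\<close> for a single variable computes its leading coefficient, and each outer \<open>f\<close> or
  \<open>g\<close> is applied to a series of order at least \<open>N\<close>, where \<open>nth_leading_argument\<close> applies.
\<close>

context
  fixes N :: nat
    and R :: "'v \<Rightarrow> 'v \<Rightarrow> 'v \<Rightarrow> 'v \<Rightarrow> 'v" and S :: "'v \<Rightarrow> 'v \<Rightarrow> 'v \<Rightarrow> 'v \<Rightarrow> 'v \<Rightarrow> 'v"
  assumes P_below: "m < N \<Longrightarrow>
      P (fps_const a) (fps_const b) (fps_const c) (fps_const d) $ m = 0"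
    and Q_below: "m < N \<Longrightarrow>
      Q (fps_const a) (fps_const b) (fps_const c) (fps_const d) (fps_const e) $ m = 0"
    and P_leading: "P (fps_const a) (fps_const b) (fps_const c) (fps_const d) $ N = R a b c d"
    and Q_leading:
      "Q (fps_const a) (fps_const b) (fps_const c) (fps_const d) (fps_const e) $ N = S a b c d e"
begin

lemmas leading_argument =
  ext_t_linear[THEN t_linear.nth_leading_argument, of N]

lemma leading_P:
  "P x (fps_const b) (fps_const c) (fps_const d) $ N = R (x $ 0) b c d"
  "P (fps_const a) x (fps_const c) (fps_const d) $ N = R a (x $ 0) c d"
  "P (fps_const a) (fps_const b) x (fps_const d) $ N = R a b (x $ 0) d"
  "P (fps_const a) (fps_const b) (fps_const c) x $ N = R a b c (x $ 0)"
  by (simp_all add: P_leading P_below P_t_linear[THEN t_linear.nth_leading_map, of N])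

lemma leading_Q:
  "Q x (fps_const b) (fps_const c) (fps_const d) (fps_const e) $ N = S (x $ 0) b c d e"
  "Q (fps_const a) x (fps_const c) (fps_const d) (fps_const e) $ N = S a (x $ 0) c d e"
  "Q (fps_const a) (fps_const b) x (fps_const d) (fps_const e) $ N = S a b (x $ 0) d e"
  "Q (fps_const a) (fps_const b) (fps_const c) x (fps_const e) $ N = S a b c (x $ 0) e"
  "Q (fps_const a) (fps_const b) (fps_const c) (fps_const d) x $ N = S a b c d (x $ 0)"
  by (simp_all add: Q_leading Q_below Q_t_linear[THEN t_linear.nth_leading_map, of N])

lemma leading_bianchi2:
  "defect2 (S a b c d) (F 0) x y =
     defect2 (G 0 a b) (R c d) x y - defect2 (G 0 c d) (R a b) x y
     - R (G 0 a b c) d x y - R c (G 0 a b d) x y"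
proof -
  let ?c = fps_const
  have "defect2 (Q (?c a) (?c b) (?c c) (?c d)) (fps_ext2 F) (?c x) (?c y) $ N
      = defect2 (S a b c d) (F 0) x y"
    unfolding defect2_def[of "defect3 _ _ _ _"]
    by (simp add: defect2_def[of "S _ _ _ _"] leading_argument leading_Q Q_below Q_leading
        ext_const_nth)
  moreover have
    "defect2 (fps_ext3 G (?c a) (?c b)) (P (?c c) (?c d)) (?c x) (?c y) $ N
       = defect2 (G 0 a b) (R c d) x y" for a b c d
    unfolding defect2_def[of _ "defect2 _ _"]
    by (simp add: defect2_def[of _ "R _ _"] leading_argument leading_P P_below P_leading
        ext_const_nth)
  moreover have
    "P (fps_ext3 G (?c a) (?c b) (?c c)) (?c d) (?c x) (?c y) $ N = R (G 0 a b c) d x y"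
    "P (?c c) (fps_ext3 G (?c a) (?c b) (?c d)) (?c x) (?c y) $ N = R c (G 0 a b d) x y"
    by (simp_all add: leading_P ext_const_nth)
  ultimately show ?thesis
    using ext.bianchi2[of "?c a" "?c b" "?c c" "?c d" "?c x" "?c y", THEN arg_cong,
        of "\<lambda>z. z $ N"]
    by simp
qed

lemma leading_bianchi3:
  "defect3 (S a b c d) (G 0) x y z =
     defect3 (G 0 a b) (S c d) x y z - defect3 (G 0 c d) (S a b) x y z
     - S (G 0 a b c) d x y z - S c (G 0 a b d) x y z"
proof -
  let ?c = fps_const
  have "defect3 (Q (?c a) (?c b) (?c c) (?c d)) (fps_ext3 G) (?c x) (?c y) (?c z) $ N
      = defect3 (S a b c d) (G 0) x y z"
    unfolding defect3_def[of "defect3 _ _ _ _"]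
    by (simp add: defect3_def[of "S _ _ _ _"] leading_argument leading_Q Q_below Q_leading
        ext_const_nth)
  moreover have
    "defect3 (fps_ext3 G (?c a) (?c b)) (Q (?c c) (?c d)) (?c x) (?c y) (?c z) $ N
       = defect3 (G 0 a b) (S c d) x y z" for a b c d
    unfolding defect3_def[of _ "defect3 _ _"]
    by (simp add: defect3_def[of _ "S _ _"] leading_argument leading_Q Q_below Q_leading
        ext_const_nth)
  moreover have
    "Q (fps_ext3 G (?c a) (?c b) (?c c)) (?c d) (?c x) (?c y) (?c z) $ N = S (G 0 a b c) d x y z"
    "Q (?c c) (fps_ext3 G (?c a) (?c b) (?c d)) (?c x) (?c y) (?c z) $ N = S c (G 0 a b d) x y z"
    by (simp_all add: leading_Q ext_const_nth)
  ultimately show ?thesis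
    using ext.bianchi3[of "?c a" "?c b" "?c c" "?c d" "?c x" "?c y" "?c z", THEN arg_cong,
        of "\<lambda>z. z $ N"]
    by simp
qed

end

end

section \<open>The obstruction as a cochain\<close>

lemma sum_atMost_eq_boundary_plus_pos_splits:
  fixes h :: "nat \<Rightarrow> nat \<Rightarrow> 'v::comm_monoid_add"
  assumes "0 < m"
  shows "(\<Sum>i\<le>m. h i (m - i)) = h 0 m + h m 0 + (\<Sum>(i, j)\<in>pos_splits m. h i j)"
proof -
  have "(\<Sum>(i, j)\<in>pos_splits m. h i j) = (\<Sum>i\<in>{1..<m}. h i (m - i))"
    by (rule sum.reindex_bij_witness[of _ "\<lambda>i. (i, m - i)" fst]) (auto simp: pos_splits_def)
  moreover have "{..m} = insert 0 (insert m {1..<m})"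
    using assms by auto
  ultimately show ?thesis
    using assms by (simp add: add.assoc)
qed

lemma multilinear2_eqs:
  assumes "multilinear2 scale f"
  shows "f (x + x') y = f x y + f x' y" "f x (y + y') = f x y + f x y'"
    "f (scale r x) y = scale r (f x y)" "f x (scale r y) = scale r (f x y)"
  using assms by (auto simp: multilinear2_def Vector_Spaces.linear_iff)

lemma multilinear3_eqs:
  assumes "multilinear3 scale g"
  shows "g (x + x') y z = g x y z + g x' y z" "g x (y + y') z = g x y z + g x y' z"
    "g x y (z + z') = g x y z + g x y z'"
    "g (scale r x) y z = scale r (g x y z)" "g x (scale r y) z = scale r (g x y z)"
    "g x y (scale r z) = scale r (g x y z)"
  using assms by (auto simp: multilinear3_def multilinear2_def Vector_Spaces.linear_iff)

lemma multilinear_additive_products: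
  "multilinear2 scale f \<Longrightarrow> multilinear3 scale g \<Longrightarrow> additive_products f g"
  by unfold_locales (simp_all add: multilinear2_eqs multilinear3_eqs)

text \<open>
  The alternation in the second pair of arguments is not termwise inherited from one inner product:
  for equal arguments \<open>x\<close> the terms \<open>F\<^sub>i(G\<^sub>j(a,b,x),x)\<close> and \<open>F\<^sub>i(x,G\<^sub>j(a,b,x))\<close> cancel by skew-symmetry of
  \<open>F\<^sub>i\<close>, and likewise in \<open>S\<close>.
\<close>

lemma quad_in_cochains45:
  fixes scale :: "'k::field \<Rightarrow> 'v::ab_group_add \<Rightarrow> 'v"
  assumes "vector_space scale" and cochain: "\<And>i. (F i, G i) \<in> cochains23 scale"
  shows "(quad_R F G m, quad_S G m) \<in> cochains45 scale"
proof -
  interpret vector_space scale by fact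
  have F: "multilinear2 scale (F i)" and G: "multilinear3 scale (G i)"
    and alt: "F i x x = 0" "G i x x c = 0" for i x c
    using cochain[of i] by (auto simp: cochains23_def)
  interpret additive_families F G
    by (rule additive_families.intro) (rule multilinear_additive_products[OF F G])
  note eqs = multilinear2_eqs[OF F] multilinear3_eqs[OF G]
  have R: "multilinear4 scale (quad_R F G m)"
    by (simp add: multilinear4_def multilinear3_def multilinear2_def Vector_Spaces.linear_iff
        vector_space_axioms quad_R_def eqs case_prod_unfold sum.distrib sum_subtractf
        scale_sum_right scale_right_diff_distrib)
  have S: "multilinear5 scale (quad_S G m)"
    by (simp add: multilinear5_def multilinear4_def multilinear3_def multilinear2_def
        Vector_Spaces.linear_iff vector_space_axioms quad_S_def eqs case_prod_unfold sum.distrib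
        sum_subtractf scale_sum_right scale_right_diff_distrib)
  have skewF: "F i x y = - F i y x" for i x y
  proof -
    have "F i x y + F i y x = F i (x + y) (x + y)"
      by (subst eqs(1)) (simp add: eqs alt)
    then show ?thesis by (simp add: alt eq_neg_iff_add_eq_0)
  qed
  have skewG: "G i x y z = - G i y x z" for i x y z
  proof -
    have "G i x y z + G i y x z = G i (x + y) (x + y) z"
      by (subst eqs(5)) (simp add: eqs alt)
    then show ?thesis by (simp add: alt eq_neg_iff_add_eq_0)
  qed
  have "quad_R F G m a b x x = 0" for a b x
    unfolding quad_R_def
    by (rule sum.neutral) (auto simp: alt skewF[of _ x "G _ a b x"])
  moreover have "quad_S G m a b x x e = 0" for a b x e
    unfolding quad_S_def
    by (rule sum.neutral) (auto simp: alt skewG[of _ x "G _ a b x"])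
  moreover have "quad_R F G m x x c d = 0" "quad_S G m x x c d e = 0" for x c d e
    by (simp_all add: quad_R_def quad_S_def alt)
  ultimately show ?thesis
    using R S by (simp add: cochains45_def)
qed

section \<open>The obstruction is a cocycle\<close>

theorem lemma4p1:
  fixes scale :: "'k::{alg_closed_field, field_char_0} \<Rightarrow> 'v::ab_group_add \<Rightarrow> 'v"
    and br :: "'v \<Rightarrow> 'v \<Rightarrow> 'v"
    and tr :: "'v \<Rightarrow> 'v \<Rightarrow> 'v \<Rightarrow> 'v"
    and n :: nat
    and F :: "nat \<Rightarrow> 'v \<Rightarrow> 'v \<Rightarrow> 'v"
    and G :: "nat \<Rightarrow> 'v \<Rightarrow> 'v \<Rightarrow> 'v \<Rightarrow> 'v"
  assumes "lie_yamaguti scale br tr"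
    and "n \<ge> 1"
    and "nth_order_deformation scale br tr n F G"
  shows "(quad_R F G (n + 1), quad_S G (n + 1)) \<in> cocycles45 scale br tr"
proof -
  interpret lie_yamaguti scale br tr by fact
  define F' where "F' i = (if i = 0 then br else if i \<le> n then F i else (\<lambda>_ _. 0))" for i
  define G' where "G' i = (if i = 0 then tr else if i \<le> n then G i else (\<lambda>_ _ _. 0))" for i
  define R where "R = quad_R F G (n + 1)"
  define S where "S = quad_S G (n + 1)"
  have trunc: "F' 0 = br" "G' 0 = tr" "F' (Suc n) = (\<lambda>_ _. 0)" "G' (Suc n) = (\<lambda>_ _ _. 0)"
    "0 < i \<Longrightarrow> i \<le> n \<Longrightarrow> F' i = F i" "0 < i \<Longrightarrow> i \<le> n \<Longrightarrow> G' i = G i" for i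
    by (simp_all add: F'_def G'_def)
  have deformation: "(F m, G m) \<in> cochains23 scale"
    "quad_R F G m a b c d = - delta23_I br tr (F m, G m) a b c d"
    "quad_S G m a b c d e = - delta23_II tr (F m, G m) a b c d e"
    if "0 < m" "m \<le> n" for m a b c d e
    using assms(3) that by (auto simp: nth_order_deformation_def)
  have quad_trunc: "quad_R F' G' m = quad_R F G m" "quad_S G' m = quad_S G m" if "m \<le> Suc n" for m
    using that
    by (auto simp: quad_R_def quad_S_def fun_eq_iff pos_splits_def trunc intro!: sum.cong)

  (* LY1 and LY2 are skew-symmetry only; cochains have to be alternating, which needs 2 to be
     invertible. *)
  have self_zero: "v = 0" if "v = - v" for v :: 'v
  proof -
    have "scale 2 v = v + v"
      using scale_left_distrib[of 1 1 v] by simp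
    also have "\<dots> = 0"
      using that by (metis add.right_inverse)
    finally show ?thesis by simp
  qed
  have cochain: "(F' i, G' i) \<in> cochains23 scale" for i
  proof (cases "i = 0 \<or> i > n")
    case True
    have "br x x = 0" "tr x x c = 0" for x c
      using self_zero LY1 LY2 by blast+
    moreover have "multilinear2 scale (\<lambda>_ _. 0)" "multilinear3 scale (\<lambda>_ _ _. 0)"
      by (simp_all add: multilinear2_def multilinear3_def Vector_Spaces.linear_iff
          vector_space_axioms)
    ultimately show ?thesis
      using True br_bilinear tr_trilinear by (auto simp: cochains23_def F'_def G'_def)
  next
    case False
    then show ?thesis by (simp add: trunc deformation)
  qed
  interpret additive_families F' G'
    using cochain
    by (intro additive_families.intro)
      (auto simp: cochains23_def intro: multilinear_additive_products)

  (* The two boundary terms i = 0 and j = 0 of the coefficient make up the coboundary delta23, up to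
     one exchange of arguments. *)
  have R_trunc: "P (fps_const a) (fps_const b) (fps_const c) (fps_const d) $ m =
      quad_R F G m a b c d + delta23_I br tr (F' m, G' m) a b c d"
    if "0 < m" "m \<le> Suc n" for m a b c d
  proof -
    have "br (G' m a b c) d = - br d (G' m a b c)"
      by (rule LY1)
    then show ?thesis
      unfolding P_const_nth
      using sum_atMost_eq_boundary_plus_pos_splits[OF that(1), of
        "\<lambda>i j. G' i a b (F' j c d) - F' i (G' j a b c) d - F' i c (G' j a b d)"]
      by (simp add: quad_trunc(1)[OF that(2), symmetric] quad_R_def delta23_I_def trunc)
  qed
  have S_trunc: "Q (fps_const a) (fps_const b) (fps_const c) (fps_const d) (fps_const e) $ m =
      quad_S G m a b c d e + delta23_II tr (F' m, G' m) a b c d e"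
    if "0 < m" "m \<le> Suc n" for m a b c d e
  proof -
    have "tr c (G' m a b d) e = - tr (G' m a b d) c e"
      by (rule LY2)
    then show ?thesis
      unfolding Q_const_nth
      using sum_atMost_eq_boundary_plus_pos_splits[OF that(1), of
        "\<lambda>i j. G' i a b (G' j c d e) - G' i (G' j a b c) d e - G' i c (G' j a b d) e
           - G' i c d (G' j a b e)"]
      by (simp add: quad_trunc(2)[OF that(2), symmetric] quad_S_def delta23_II_def trunc)
  qed
  have below:
    "P (fps_const a) (fps_const b) (fps_const c) (fps_const d) $ m = 0"
    "Q (fps_const a) (fps_const b) (fps_const c) (fps_const d) (fps_const e) $ m = 0"
    if "m < Suc n" for m a b c d e
  proof -
    show "P (fps_const a) (fps_const b) (fps_const c) (fps_const d) $ m = 0"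
    proof (cases "m = 0")
      case True
      then show ?thesis by (simp add: P_const_nth trunc LY5[of a b c d])
    next
      case False
      then show ?thesis using that by (simp add: R_trunc deformation trunc)
    qed
    show "Q (fps_const a) (fps_const b) (fps_const c) (fps_const d) (fps_const e) $ m = 0"
    proof (cases "m = 0")
      case True
      then show ?thesis by (simp add: Q_const_nth trunc LY6[of a b c d e])
    next
      case False
      then show ?thesis using that by (simp add: S_trunc deformation trunc)
    qed
  qed
  (* The coboundary of (F' (n + 1), G' (n + 1)) = (0, 0) contributes nothing here. *)
  have leading:
    "P (fps_const a) (fps_const b) (fps_const c) (fps_const d) $ Suc n = R a b c d"
    "Q (fps_const a) (fps_const b) (fps_const c) (fps_const d) (fps_const e) $ Suc n
       = S a b c d e" for a b c d e
    using coeff.zeros[of 0]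
    by (simp_all add: R_trunc S_trunc R_def S_def delta23_I_def delta23_II_def trunc)

  have "delta45_I br tr (R, S) x1 x2 x3 x4 x5 x6 = 0" for x1 x2 x3 x4 x5 x6
  proof -
    have "br (S x1 x2 x3 x4 x5) x6 = - br x6 (S x1 x2 x3 x4 x5)"
      by (rule LY1)
    then show ?thesis
      using leading_bianchi2[OF below leading, of x1 x2 x3 x4 x5 x6]
      by (simp add: delta45_I_def defect2_def trunc algebra_simps)
  qed
  moreover have "delta45_II tr (R, S) x1 x2 x3 x4 x5 x6 x7 = 0" for x1 x2 x3 x4 x5 x6 x7
  proof -
    have "tr x5 (S x1 x2 x3 x4 x6) x7 = - tr (S x1 x2 x3 x4 x6) x5 x7"
      by (rule LY2)
    then show ?thesis
      using leading_bianchi3[OF below leading, of x1 x2 x3 x4 x5 x6 x7]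
      by (simp add: delta45_II_def defect3_def trunc algebra_simps)
  qed
  moreover have "(R, S) \<in> cochains45 scale"
    unfolding R_def S_def
    using quad_in_cochains45[of scale F' G' "n + 1", OF vector_space_axioms cochain]
    by (simp add: quad_trunc)
  ultimately show ?thesis
    unfolding R_def S_def by (simp add: cocycles45_def delta45_def fun_eq_iff)
qed

end
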